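(* Let $N\ge1$ and let $b,\beta,c,\gamma,\Gamma:\mathbb{R}^N\to\mathbb{R}$ be locally Lipschitz on $\mathbb{R}^N$ and satisfy growth condition (A) or growth condition (B) (defined in the context). Then, for any initial condition $z(0)\in\mathbb{R}^N$, the solution of the non-linear ODE $$\bar z'(t)=\mathbf{L}(z(t))\,\bar z(t),\qquad \bar z(t)=(1,z(t)),\quad z(t)\in\mathbb{R}^N,$$ is global, i.e. it exists for all $t\in[0,\infty)$. Here, for $j,k=0,\dots,N$, $$\mathbf{L}(z)_{kj}=\begin{cases}k\beta(z)+\frac{k(k-1)}2\Gamma(z)&k=j,\ k\ne0\\ k\,b(z)+\frac{k(k-1)}2\gamma(z)&k=j+1\\ \frac{k(k-1)}2c(z)&k=j+2\\0&\text{else.}\end{cases}$$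
   Context: For $x\in\mathbb{R}^N$ put $\|x\|_N:=\big(\sum_{i=1}^N|x_i|^{2/i}\big)^{1/2}$. Growth condition (A): for all $x\in\mathbb{R}^N$, (i) $|\beta(x)|\le\beta_0$ and $|\Gamma(x)|\le\Gamma_0$ for some constants $\beta_0,\Gamma_0\ge0$; (ii) there are $c_0\in\mathbb{R}$ and a continuous increasing $f_c:\mathbb{R}_{\ge0}\to\mathbb{R}_{\ge0}$ with $|c(x)|\le c_0(1+f_c(|x_1|)+\|x\|_N^2)$; (iii) there are $b_0,\gamma_0\in\mathbb{R}$ and a continuous increasing $f_\gamma:\mathbb{R}_{\ge0}\to\mathbb{R}_{\ge0}$ with $|\gamma(x)|\le\gamma_0(1+f_\gamma(|x_1|)+\|x\|_N)$ and $|b(x)|\le b_0(1+|x_1|)$. Growth condition (B): for all $x\in\mathbb{R}^N$, (i) $|\beta(x)|\le\beta_0$ and $|\Gamma(x)|\le\Gamma_0$ for some $\beta_0,\Gamma_0\ge0$; (ii) $|c(x)|\le c_0(1+\|x\|_N^2)$ for some $c_0\in\mathbb{R}$; (iii) $|\gamma(x)|\le\gamma_0(1+\|x\|_N)$ and $|b(x)|\le b_0(1+\|x\|_N)$ for some $b_0,\gamma_0\in\mathbb{R}$. *)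

theory Defs
  imports "HOL-Analysis.Analysis"
begin

text \<open>
  Vectors in \<open>\<real>\<^sup>N\<close> are elements of \<open>real ^ 'n\<close> with \<open>N = CARD('n)\<close>. The statement refers to the
  numbers of the coordinates, so a numbering \<open>pos\<close>, a bijection from \<open>'n\<close> onto \<open>{1..N}\<close>, is carried
  along; the \<open>k\<close>-th coordinate of \<open>x\<close> is the one at the index \<open>i\<close> with \<open>pos i = k\<close>.
  Vectors in \<open>\<real>\<^bsup>N+1\<^esup>\<close> with coordinates \<open>0, \<dots>, N\<close> are elements of \<open>real ^ 'n option\<close>, where
  \<open>None\<close> has number \<open>0\<close> and \<open>Some i\<close> has number \<open>pos i\<close>.
\<close>

definition numbering :: "('n::finite \<Rightarrow> nat) \<Rightarrow> bool" where
  "numbering pos \<longleftrightarrow> bij_betw pos UNIV {1..CARD('n)}"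

definition first_coord :: "('n::finite \<Rightarrow> nat) \<Rightarrow> real ^ 'n \<Rightarrow> real" where
  "first_coord pos x = x $ (THE i. pos i = 1)"

(* Since 0 powr a = 0, vanishing coordinates contribute 0. *)
definition normN :: "('n::finite \<Rightarrow> nat) \<Rightarrow> real ^ 'n \<Rightarrow> real" where
  "normN pos x = sqrt (\<Sum>i\<in>UNIV. \<bar>x $ i\<bar> powr (2 / real (pos i)))"

(* The library notion is for time-dependent maps; here the time dependence is constant. *)
definition locally_lipschitz :: "('a::metric_space \<Rightarrow> 'b::metric_space) \<Rightarrow> bool" where
  "locally_lipschitz f \<longleftrightarrow> local_lipschitz (UNIV :: real set) UNIV (\<lambda>_. f)"

(* Continuous increasing function from the nonnegative reals to themselves; "increasing" is
   read as nondecreasing, so strictly increasing functions are included. *)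
definition growth_function :: "(real \<Rightarrow> real) \<Rightarrow> bool" where
  "growth_function f \<longleftrightarrow> continuous_on {0..} f \<and> mono_on {0..} f \<and> f ` {0..} \<subseteq> {0..}"

definition growth_A ::
  "('n::finite \<Rightarrow> nat) \<Rightarrow> (real ^ 'n \<Rightarrow> real) \<Rightarrow> (real ^ 'n \<Rightarrow> real) \<Rightarrow> (real ^ 'n \<Rightarrow> real)
    \<Rightarrow> (real ^ 'n \<Rightarrow> real) \<Rightarrow> (real ^ 'n \<Rightarrow> real) \<Rightarrow> bool" where
  "growth_A pos b \<beta> c \<gamma> \<Gamma> \<longleftrightarrow>
    (\<exists>\<beta>0\<ge>0. \<exists>\<Gamma>0\<ge>0. \<forall>x. \<bar>\<beta> x\<bar> \<le> \<beta>0 \<and> \<bar>\<Gamma> x\<bar> \<le> \<Gamma>0) \<and>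
    (\<exists>c0 f. growth_function f \<and>
      (\<forall>x. \<bar>c x\<bar> \<le> c0 * (1 + f \<bar>first_coord pos x\<bar> + (normN pos x)\<^sup>2))) \<and>
    (\<exists>b0 \<gamma>0 f. growth_function f \<and>
      (\<forall>x. \<bar>\<gamma> x\<bar> \<le> \<gamma>0 * (1 + f \<bar>first_coord pos x\<bar> + normN pos x) \<and>
           \<bar>b x\<bar> \<le> b0 * (1 + \<bar>first_coord pos x\<bar>)))"

definition growth_B ::
  "('n::finite \<Rightarrow> nat) \<Rightarrow> (real ^ 'n \<Rightarrow> real) \<Rightarrow> (real ^ 'n \<Rightarrow> real) \<Rightarrow> (real ^ 'n \<Rightarrow> real)
    \<Rightarrow> (real ^ 'n \<Rightarrow> real) \<Rightarrow> (real ^ 'n \<Rightarrow> real) \<Rightarrow> bool" where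
  "growth_B pos b \<beta> c \<gamma> \<Gamma> \<longleftrightarrow>
    (\<exists>\<beta>0\<ge>0. \<exists>\<Gamma>0\<ge>0. \<forall>x. \<bar>\<beta> x\<bar> \<le> \<beta>0 \<and> \<bar>\<Gamma> x\<bar> \<le> \<Gamma>0) \<and>
    (\<exists>c0. \<forall>x. \<bar>c x\<bar> \<le> c0 * (1 + (normN pos x)\<^sup>2)) \<and>
    (\<exists>b0 \<gamma>0. \<forall>x. \<bar>\<gamma> x\<bar> \<le> \<gamma>0 * (1 + normN pos x) \<and> \<bar>b x\<bar> \<le> b0 * (1 + normN pos x))"

definition pos0 :: "('n \<Rightarrow> nat) \<Rightarrow> 'n option \<Rightarrow> nat" where
  "pos0 pos r = (case r of None \<Rightarrow> 0 | Some i \<Rightarrow> pos i)"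

definition bar :: "real ^ 'n \<Rightarrow> real ^ ('n::finite) option" where
  "bar z = (\<chi> r. case r of None \<Rightarrow> 1 | Some i \<Rightarrow> z $ i)"

definition Lmat ::
  "('n::finite \<Rightarrow> nat) \<Rightarrow> (real ^ 'n \<Rightarrow> real) \<Rightarrow> (real ^ 'n \<Rightarrow> real) \<Rightarrow> (real ^ 'n \<Rightarrow> real)
    \<Rightarrow> (real ^ 'n \<Rightarrow> real) \<Rightarrow> (real ^ 'n \<Rightarrow> real) \<Rightarrow> real ^ 'n \<Rightarrow> real ^ 'n option ^ 'n option" where
  "Lmat pos b \<beta> c \<gamma> \<Gamma> z = (\<chi> row col.
    let k = pos0 pos row; j = pos0 pos col in
      if k = j \<and> k \<noteq> 0 then real k * \<beta> z + real k * (real k - 1) / 2 * \<Gamma> z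
      else if k = j + 1 then real k * b z + real k * (real k - 1) / 2 * \<gamma> z
      else if k = j + 2 then real k * (real k - 1) / 2 * c z
      else 0)"

(* z solves bar z' = L(z) bar z on the set J of times; at an end point of J contained in J the
   derivative is one-sided. *)
definition solves_on ::
  "(real ^ 'n \<Rightarrow> real ^ 'n option ^ 'n option) \<Rightarrow> real set \<Rightarrow> (real \<Rightarrow> real ^ ('n::finite)) \<Rightarrow> bool" where
  "solves_on L J z \<longleftrightarrow>
    (\<forall>t\<in>J. ((\<lambda>s. bar (z s)) has_vector_derivative (L (z t) *v bar (z t))) (at t within J))"

end

theory Submission
  imports Defs
begin

text \<open>
  Give the \<open>k\<close>-th coordinate the weight \<open>k\<close>. If \<open>\<beta>, \<Gamma>\<close> are bounded, \<open>b, \<gamma>\<close> grow at most like the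
  weighted radius \<open>\<rho>\<close> and \<open>c\<close> at most like \<open>\<rho>\<^sup>2\<close>, then the \<open>k\<close>-th component of the vector field
  is \<open>O(\<rho>\<^sup>k)\<close>, because the entry \<open>(k, j)\<close> of the matrix is \<open>O(\<rho>\<^bsup>k-j\<^esup>)\<close> and vanishes for \<open>k < j\<close>.
  Hence \<open>W = 1 + (\<Sum>k. z\<^sub>k\<^bsup>2 N! / k\<^esup>)\<close>, which is comparable to \<open>\<rho>\<^bsup>2 N!\<^esup>\<close>, satisfies
  \<open>W' \<le> C W\<close>, and Gronwall's lemma excludes blow-up. Under condition (A) the first equation
  \<open>z\<^sub>1' = \<beta>(z) z\<^sub>1 + b(z)\<close> alone bounds \<open>z\<^sub>1\<close> on bounded time intervals, and for bounded \<open>z\<^sub>1\<close> condition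
  (A) implies (B). Global existence follows from the a priori bound by truncating the vector field
  outside a large ball, which makes it globally Lipschitz.
\<close>

subsection \<open>Ordinary differential equations\<close>

text \<open>Multiplying by the integrating factor \<open>exp (- C * s)\<close> turns the inequality
  into monotonicity. This works for either sign of \<open>C\<close> and of
  \<open>\<phi>\<close>.\<close>

lemma differential_gronwall:
  fixes \<phi> \<phi>' :: "real \<Rightarrow> real"
  assumes "0 \<le> t"
    and der: "\<And>s. s \<in> {0..t} \<Longrightarrow> (\<phi> has_vector_derivative \<phi>' s) (at s within {0..t})"
    and le: "\<And>s. s \<in> {0..t} \<Longrightarrow> \<phi>' s \<le> C * \<phi> s"
  shows "\<phi> t \<le> \<phi> 0 * exp (C * t)"
proof -
  define g where "g s = \<phi> s * exp (- C * s)" for s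
  have cont: "continuous_on {0..t} \<phi>"
    by (rule continuous_on_vector_derivative) (use der in auto)
  have "g 0 \<ge> g t"
  proof (rule DERIV_nonpos_imp_decreasing_open[OF \<open>0 \<le> t\<close>])
    fix s assume s: "0 < s" "s < t"
    have "(\<phi> has_real_derivative \<phi>' s) (at s)"
      using der[of s] s by (simp add: at_within_Icc_at has_real_derivative_iff_has_vector_derivative)
    then have "(g has_real_derivative (\<phi>' s - C * \<phi> s) * exp (- C * s)) (at s)"
      unfolding g_def by (auto intro!: derivative_eq_intros simp: algebra_simps)
    moreover have "(\<phi>' s - C * \<phi> s) * exp (- C * s) \<le> 0"
      using le[of s] s by (intro mult_nonpos_nonneg) auto
    ultimately show "\<exists>y. DERIV g s :> y \<and> y \<le> 0"
      by blast
  qed (auto simp: g_def intro!: continuous_intros cont)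
  then have "g t * exp (C * t) \<le> g 0 * exp (C * t)"
    by (intro mult_right_mono) auto
  then show ?thesis
    by (simp add: g_def mult.assoc flip: exp_add)
qed

text \<open>Banach's fixed point theorem for the Picard operator; conjugating it by the weight \<open>exp (K * t)\<close>
  makes it a contraction on the whole of \<open>[0, T]\<close>, so no gluing of local solutions is needed.\<close>

lemma picard_lipschitz:
  fixes G :: "'a::banach \<Rightarrow> 'a"
  assumes lip: "L-lipschitz_on UNIV G" and "0 \<le> T"
  obtains z where "z 0 = x0"
    "\<And>t. t \<in> {0..T} \<Longrightarrow> (z has_vector_derivative G (z t)) (at t within {0..T})"
proof -
  \<comment> \<open>The contraction constant will be \<open>L / K\<close>; this choice makes it at
    most 1/2, and the summand 1 keeps \<open>K\<close> positive when \<open>L = 0\<close>.\<close>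
  define K where "K = 2 * L + 1"
  have L: "0 \<le> L" using lip by (rule lipschitz_on_nonneg)
  then have K: "K > 0" "L \<le> K / 2" by (auto simp: K_def)
  have contG: "continuous_on A G" for A
    using lipschitz_on_continuous_on[OF lip] continuous_on_subset by blast
  \<comment> \<open>Here \<open>w t\<close> stands for \<open>exp (- K * t) *\<^sub>R z t\<close>
    with \<open>z\<close> the sought solution, so \<open>u w\<close> is \<open>G\<close> along the
    unweighted curve and \<open>P\<close> is the conjugated Picard operator.\<close>
  define u where "u w s = G (exp (K * s) *\<^sub>R apply_bcontfun w s)" for w s
  define P where "P w t = exp (- K * t) *\<^sub>R (x0 + integral {0..t} (u w))" for w t
  have contu: "continuous_on A (u w)" for w A
    unfolding u_def
    by (rule continuous_on_compose2[OF contG[of UNIV]]) (auto intro!: continuous_intros)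
  have integ: "(u w) integrable_on {0..t}" for w t
    by (rule integrable_continuous_real[OF contu])
  \<comment> \<open>Elements of the complete space of bounded continuous functions live on the whole
    line, so \<open>P w\<close> is continued by its end values outside
    \<open>[0, T]\<close>.\<close>
  have "\<exists>g. \<forall>x. apply_bcontfun g x = P w (clamp 0 T x)" for w
  proof -
    have "continuous_on (cbox 0 T) (P w)"
      unfolding P_def
      by (auto intro!: continuous_intros indefinite_integral_continuous_1 integ)
    then show ?thesis
      by (rule continuous_on_cbox_bcontfunE) blast
  qed
  then obtain \<Phi> where \<Phi>: "\<And>w x. apply_bcontfun (\<Phi> w) x = P w (clamp 0 T x)"
    by metis
  have contr: "dist (P w t) (P v t) \<le> 1 / 2 * dist w v" if "0 \<le> t" for w v t
  proof -
    \<comment> \<open>Integrating the growing weight gains the factor \<open>1 / K\<close>; the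
      outer factor \<open>exp (- K * t)\<close> then cancels \<open>exp (K * t)\<close>, whatever
      the length of the interval.\<close>
    have hi: "((\<lambda>s. L * dist w v * exp (K * s)) has_integral
        (L * dist w v / K * exp (K * t) - L * dist w v / K * exp (K * 0))) {0..t}"
    proof (rule fundamental_theorem_of_calculus[OF \<open>0 \<le> t\<close>])
      fix s
      have "((\<lambda>s. L * dist w v / K * exp (K * s)) has_real_derivative L * dist w v * exp (K * s))
          (at s within {0..t})"
        using K(1) by (auto intro!: derivative_eq_intros)
      then show "((\<lambda>s. L * dist w v / K * exp (K * s)) has_vector_derivative
          L * dist w v * exp (K * s)) (at s within {0..t})"
        by (simp add: has_real_derivative_iff_has_vector_derivative)
    qed
    have "norm (integral {0..t} (\<lambda>s. u w s - u v s)) \<le> integral {0..t} (\<lambda>s. L * dist w v * exp (K * s))"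
    proof (rule integral_norm_bound_integral)
      show "(\<lambda>s. u w s - u v s) integrable_on {0..t}"
        by (intro integrable_diff integ)
      show "(\<lambda>s. L * dist w v * exp (K * s)) integrable_on {0..t}"
        using hi by blast
      fix s
      have "norm (u w s - u v s) \<le> L * dist (exp (K * s) *\<^sub>R w s) (exp (K * s) *\<^sub>R v s)"
        using lipschitz_onD[OF lip] by (simp add: u_def flip: dist_norm)
      also have "\<dots> = L * (exp (K * s) * dist (w s) (v s))"
        by (simp add: dist_norm flip: scaleR_diff_right)
      also have "\<dots> \<le> L * (exp (K * s) * dist w v)"
        using L dist_bounded[of w s v] by (intro mult_left_mono) auto
      finally show "norm (u w s - u v s) \<le> L * dist w v * exp (K * s)"
        by (simp add: mult_ac)
    qed
    also have "\<dots> \<le> L * dist w v / K * exp (K * t)"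
      using K L by (simp add: integral_unique[OF hi] del: integral_mult_right)
    finally have "norm (integral {0..t} (\<lambda>s. u w s - u v s)) \<le> L * dist w v / K * exp (K * t)" .
    then have "exp (- K * t) * norm (integral {0..t} (\<lambda>s. u w s - u v s))
        \<le> exp (- K * t) * (L * dist w v / K * exp (K * t))"
      by (intro mult_left_mono) auto
    also have "\<dots> = L * dist w v / K * (exp (- K * t) * exp (K * t))"
      by (simp only: mult_ac)
    also have "\<dots> = L * dist w v / K"
      by (simp flip: exp_add)
    finally have "exp (- K * t) * norm (integral {0..t} (\<lambda>s. u w s - u v s)) \<le> L * dist w v / K" .
    moreover have "P w t - P v t = exp (- K * t) *\<^sub>R integral {0..t} (\<lambda>s. u w s - u v s)"
      by (simp add: P_def integral_diff[OF integ integ] algebra_simps)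
    ultimately have "dist (P w t) (P v t) \<le> L * dist w v / K"
      by (simp add: dist_norm)
    also have "\<dots> \<le> 1 / 2 * dist w v"
      using K mult_right_mono[OF K(2), of "dist w v"] by (simp add: field_simps)
    finally show ?thesis .
  qed
  have clamp01: "clamp 0 T x \<in> {0..T}" for x
    using clamp_in_interval[of 0 T x] \<open>0 \<le> T\<close> by (simp add: box_real)
  have "\<exists>!w. \<Phi> w = w"
  proof (rule banach_fix_type[of "1 / 2"])
    show "\<forall>w v. dist (\<Phi> w) (\<Phi> v) \<le> 1 / 2 * dist w v"
      using clamp01 by (auto intro!: dist_bound contr simp: \<Phi> simp del: times_divide_eq_left)
  qed auto
  then obtain w where w: "\<Phi> w = w" by blast
  define z where "z t = x0 + integral {0..t} (u w)" for t
  have uw: "u w t = G (z t)" if "t \<in> {0..T}" for t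
  proof -
    have "apply_bcontfun w t = P w t"
      using \<Phi>[of w t] that by (simp add: w)
    then show ?thesis
      by (simp add: u_def P_def z_def flip: exp_add)
  qed
  show thesis
  proof
    show "z 0 = x0" by (simp add: z_def)
    fix t assume t: "t \<in> {0..T}"
    show "(z has_vector_derivative G (z t)) (at t within {0..T})"
      unfolding z_def uw[OF t, unfolded z_def, symmetric]
      using integral_has_vector_derivative[OF contu t, of w]
      by (auto intro!: derivative_eq_intros)
  qed
qed

text \<open>On a compact interval both curves stay in a common ball, where \<open>F\<close> has one
  Lipschitz constant. Gronwall for the squared distance, which starts at 0, does the rest.\<close>

lemma ode_unique:
  fixes F :: "'a::euclidean_space \<Rightarrow> 'a"
  assumes lip: "\<And>R. \<exists>L. L-lipschitz_on (cball 0 R) F"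
    and "0 \<le> t" and init: "u 0 = v 0"
    and du: "\<And>s. s \<in> {0..t} \<Longrightarrow> (u has_vector_derivative F (u s)) (at s within {0..t})"
    and dv: "\<And>s. s \<in> {0..t} \<Longrightarrow> (v has_vector_derivative F (v s)) (at s within {0..t})"
  shows "u t = v t"
proof -
  have "continuous_on {0..t} u"
    by (rule continuous_on_vector_derivative) (rule du)
  moreover have "continuous_on {0..t} v"
    by (rule continuous_on_vector_derivative) (rule dv)
  ultimately have "bounded (u ` {0..t} \<union> v ` {0..t})"
    by (simp add: compact_continuous_image compact_imp_bounded)
  then obtain R where R: "u ` {0..t} \<union> v ` {0..t} \<subseteq> cball 0 R"
    using bounded_subset_ballD[of _ 0] ball_subset_cball by (metis order_trans)
  obtain L where L: "L-lipschitz_on (cball 0 R) F" using lip by blast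
  define d where "d s = u s - v s" for s
  have "d t \<bullet> d t \<le> d 0 \<bullet> d 0 * exp (2 * L * t)"
  proof (rule differential_gronwall[OF \<open>0 \<le> t\<close>])
    fix s assume s: "s \<in> {0..t}"
    have dd: "(d has_vector_derivative (F (u s) - F (v s))) (at s within {0..t})"
      unfolding d_def using du[OF s] dv[OF s] by (rule has_vector_derivative_diff)
    show "((\<lambda>s. d s \<bullet> d s) has_vector_derivative 2 * (d s \<bullet> (F (u s) - F (v s)))) (at s within {0..t})"
      using bounded_bilinear.has_vector_derivative[OF bounded_bilinear_inner dd dd]
      by (simp add: inner_commute)
    have "d s \<bullet> (F (u s) - F (v s)) \<le> norm (d s) * norm (F (u s) - F (v s))"
      by (rule norm_cauchy_schwarz)
    also have "\<dots> \<le> norm (d s) * (L * norm (d s))"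
      using lipschitz_onD[OF L, of "u s" "v s"] R s
      by (intro mult_left_mono) (auto simp: d_def dist_norm image_subset_iff)
    finally show "2 * (d s \<bullet> (F (u s) - F (v s))) \<le> 2 * L * (d s \<bullet> d s)"
      by (simp add: dot_square_norm power2_eq_square mult_ac)
  qed
  then show ?thesis
    by (simp add: d_def init dot_square_norm)
qed

text \<open>The a priori bound has to cover solutions on every \<open>[0, t]\<close> with
  \<open>t \<le> T\<close>, with one \<open>R\<close>: a solution of the truncated equation is known
  to solve the original one only until it leaves the ball.\<close>

theorem ode_global_existence:
  fixes F :: "'a::euclidean_space \<Rightarrow> 'a"
  assumes lip: "\<And>R. \<exists>L. L-lipschitz_on (cball 0 R) F"
    and apriori: "\<And>T. 0 \<le> T \<Longrightarrow> \<exists>R. \<forall>z. \<forall>t\<in>{0..T}. z 0 = x0 \<and>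
      (\<forall>s\<in>{0..t}. (z has_vector_derivative F (z s)) (at s within {0..t})) \<longrightarrow> norm (z t) \<le> R"
  shows "\<exists>z. z 0 = x0 \<and> (\<forall>t\<ge>0. (z has_vector_derivative F (z t)) (at t within {0..}))"
proof -
  have ex: "\<exists>z. z 0 = x0 \<and> (\<forall>t\<in>{0..T}. (z has_vector_derivative F (z t)) (at t within {0..T}))"
    if T: "0 \<le> T" for T
  proof -
    obtain R where R: "\<And>z t. \<lbrakk>0 \<le> t; t \<le> T; z 0 = x0;
        \<And>s. s \<in> {0..t} \<Longrightarrow> (z has_vector_derivative F (z s)) (at s within {0..t})\<rbrakk> \<Longrightarrow> norm (z t) \<le> R"
      using apriori[OF T] by (metis atLeastAtMost_iff)
    \<comment> \<open>On the degenerate interval \<open>{0..0}\<close> every curve counts as a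
      solution, since \<open>at 0 within {0}\<close> is the trivial filter; hence the bound applies
      to the initial value.\<close>
    have x0R: "norm x0 \<le> R"
      using R[of 0 "\<lambda>_. x0"] T
      by (simp add: has_vector_derivative_def has_derivative_def at_within_def bounded_linear_scaleR_left)
    define B where "B = cball (0::'a) (R + 1)"
    have "0 \<le> R" using x0R norm_ge_zero order_trans by blast
    then have B: "convex B" "closed B" "B \<noteq> {}"
      by (auto simp: B_def)
    obtain L where L: "L-lipschitz_on B F" unfolding B_def using lip by blast
    \<comment> \<open>Projection onto the convex set \<open>B\<close> is nonexpansive and fixes
      \<open>B\<close>, so \<open>G\<close> is globally Lipschitz with the same constant and agrees
      with \<open>F\<close> on \<open>B\<close>.\<close>
    define G where "G x = F (closest_point B x)" for x
    have "L-lipschitz_on UNIV G"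
    proof (rule lipschitz_onI)
      fix x y
      have "dist (G x) (G y) \<le> L * dist (closest_point B x) (closest_point B y)"
        unfolding G_def by (intro lipschitz_onD[OF L] closest_point_in_set B)
      also have "\<dots> \<le> L * dist x y"
        by (intro mult_left_mono closest_point_lipschitz B lipschitz_on_nonneg[OF L])
      finally show "dist (G x) (G y) \<le> L * dist x y" .
    qed (rule lipschitz_on_nonneg[OF L])
    then obtain z where z0: "z 0 = x0"
      and dz: "\<And>t. t \<in> {0..T} \<Longrightarrow> (z has_vector_derivative G (z t)) (at t within {0..T})"
      using picard_lipschitz[OF _ T] by metis
    have contz: "continuous_on {0..T} z"
      by (rule continuous_on_vector_derivative) (use dz in auto)
    have bound: "norm (z t) \<le> R" if t: "t \<in> {0..T}" for t
    proof (rule ccontr)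
      assume "\<not> norm (z t) \<le> R"
      \<comment> \<open>The level \<open>q\<close> lies strictly above \<open>R\<close> but still
        within \<open>B\<close>. Up to the first time \<open>\<tau>\<close> at which the norm
        reaches \<open>q\<close>, the curve solves the original equation, so the a priori bound
        gives norm at most \<open>R\<close> at \<open>\<tau>\<close>, a contradiction.\<close>
      define q where "q = min (norm (z t)) (R + 1)"
      define S where "S = {s \<in> {0..t}. q \<le> norm (z s)}"
      have q: "R < q" "q \<le> R + 1" "q \<le> norm (z t)"
        using \<open>\<not> norm (z t) \<le> R\<close> by (auto simp: q_def)
      have cont: "continuous_on {0..t} (\<lambda>s. norm (z s))"
        by (rule continuous_on_norm, rule continuous_on_subset[OF contz]) (use t in auto)
      have "closed S" unfolding S_def
        using continuous_on_closed_Collect_le[OF continuous_on_const cont] by simp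
      moreover have "t \<in> S" using q t by (auto simp: S_def)
      moreover have "bdd_below S" by (rule bdd_belowI[of _ 0]) (auto simp: S_def)
      ultimately have "Inf S \<in> S" using closed_contains_Inf by blast
      define \<tau> where "\<tau> = Inf S"
      have \<tau>: "0 \<le> \<tau>" "\<tau> \<le> t" "q \<le> norm (z \<tau>)"
        using \<open>Inf S \<in> S\<close> by (auto simp: \<tau>_def S_def)
      have less: "norm (z s) < q" if "0 \<le> s" "s < \<tau>" for s
        using cInf_lower[OF _ \<open>bdd_below S\<close>, of s] that \<tau> by (force simp: \<tau>_def S_def)
      have "\<exists>s. 0 \<le> s \<and> s \<le> \<tau> \<and> norm (z s) = q"
        using \<tau> x0R q z0
        by (intro IVT') (auto intro: continuous_on_subset[OF cont])
      then have q\<tau>: "norm (z \<tau>) = q"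
        using less by (metis less_irrefl order_le_less)
      have inB: "z s \<in> B" if "s \<in> {0..\<tau>}" for s
        using less[of s] q\<tau> q that by (cases "s = \<tau>") (auto simp: B_def)
      have "norm (z \<tau>) \<le> R"
      proof (rule R)
        show "(z has_vector_derivative F (z s)) (at s within {0..\<tau>})" if s: "s \<in> {0..\<tau>}" for s
          using has_vector_derivative_within_subset[OF dz[of s], of "{0..\<tau>}"] inB[OF s] s \<tau> t
          by (simp add: G_def closest_point_self)
      qed (use \<tau> t z0 in auto)
      then show False
        using q\<tau> q by simp
    qed
    have "G (z t) = F (z t)" if "t \<in> {0..T}" for t
      using bound[OF that] by (simp add: G_def B_def closest_point_self)
    then show ?thesis
      using z0 dz by auto
  qed
  then obtain Z where Z0: "\<And>T. 0 \<le> T \<Longrightarrow> Z T 0 = x0"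
    and dZ: "\<And>T t. \<lbrakk>0 \<le> T; t \<in> {0..T}\<rbrakk> \<Longrightarrow> (Z T has_vector_derivative F (Z T t)) (at t within {0..T})"
    by metis
  have agree: "Z S t = Z T t" if "0 \<le> t" "t \<le> S" "t \<le> T" for S T t
  proof (rule ode_unique[OF lip \<open>0 \<le> t\<close>])
    show "Z S 0 = Z T 0" using that by (simp add: Z0)
    show "(Z S has_vector_derivative F (Z S s)) (at s within {0..t})" if "s \<in> {0..t}" for s
      by (rule has_vector_derivative_within_subset[OF dZ]) (use that \<open>t \<le> S\<close> in auto)
    show "(Z T has_vector_derivative F (Z T s)) (at s within {0..t})" if "s \<in> {0..t}" for s
      by (rule has_vector_derivative_within_subset[OF dZ]) (use that \<open>t \<le> T\<close> in auto)
  qed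
  \<comment> \<open>With \<open>t + 1\<close> instead of \<open>t\<close>, the interval contains a
    neighbourhood of \<open>t\<close> relative to \<open>[0, \<infinity>)\<close>, so the derivative
    there is the required one and not just a left derivative.\<close>
  define z where "z t = Z (t + 1) t" for t
  show ?thesis
  proof (intro exI conjI allI impI)
    show "z 0 = x0" by (simp add: z_def Z0)
    fix t :: real assume t: "0 \<le> t"
    have nhd: "at t within {0..} = at t within {0..t + 1}"
      by (rule at_within_nhd[of _ "{..<t + 1}"]) auto
    have "(Z (t + 1) has_vector_derivative F (z t)) (at t within {0..t + 1})"
      using dZ[of "t + 1" t] t by (simp add: z_def)
    then have "(z has_vector_derivative F (z t)) (at t within {0..t + 1})"
      by (rule has_vector_derivative_transform[rotated 2]) (use t in \<open>auto simp: z_def intro!: agree\<close>)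
    then show "(z has_vector_derivative F (z t)) (at t within {0..})"
      by (simp add: nhd)
  qed
qed

subsection \<open>Lipschitz continuity on balls\<close>

definition lipschitz_on_balls :: "('a::real_normed_vector \<Rightarrow> 'b::metric_space) \<Rightarrow> bool" where
  "lipschitz_on_balls f \<longleftrightarrow> (\<forall>R. \<exists>L. L-lipschitz_on (cball 0 R) f)"

text \<open>Closed balls are compact in finite dimension, and a locally Lipschitz map has a single
  Lipschitz constant on a compact set.\<close>

lemma locally_lipschitz_imp_lipschitz_on_balls:
  fixes f :: "'a::euclidean_space \<Rightarrow> 'b::metric_space"
  assumes "locally_lipschitz f"
  shows "lipschitz_on_balls f"
proof -
  have "\<exists>L. L-lipschitz_on (cball 0 R) f" for R
  proof (rule local_lipschitz_compact_implies_lipschitz)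
    show "local_lipschitz {0::real} (cball 0 R) (\<lambda>_. f)"
      using assms unfolding locally_lipschitz_def by (rule local_lipschitz_subset) auto
  qed auto
  then show ?thesis
    by (simp add: lipschitz_on_balls_def)
qed

lemma lipschitz_on_balls_const: "lipschitz_on_balls (\<lambda>x. c)"
  unfolding lipschitz_on_balls_def using lipschitz_on_constant by blast

lemma lipschitz_on_balls_component: "lipschitz_on_balls (\<lambda>x::real ^ 'n. x $ i)"
proof -
  have "1-lipschitz_on U (\<lambda>x::real ^ 'n. x $ i)" for U
    by (rule lipschitz_onI) (auto simp: dist_vec_nth_le)
  then show ?thesis
    unfolding lipschitz_on_balls_def by blast
qed

lemma lipschitz_on_balls_add:
  fixes f g :: "'a::real_normed_vector \<Rightarrow> 'b::real_normed_vector"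
  assumes "lipschitz_on_balls f" "lipschitz_on_balls g"
  shows "lipschitz_on_balls (\<lambda>x. f x + g x)"
  using assms unfolding lipschitz_on_balls_def by (blast intro: lipschitz_on_add)

lemma lipschitz_on_balls_sum:
  fixes f :: "'i \<Rightarrow> 'a::real_normed_vector \<Rightarrow> 'b::real_normed_vector"
  assumes "\<And>i. i \<in> I \<Longrightarrow> lipschitz_on_balls (f i)"
  shows "lipschitz_on_balls (\<lambda>x. \<Sum>i\<in>I. f i x)"
  using assms
  by (induction I rule: infinite_finite_induct)
    (auto intro: lipschitz_on_balls_add lipschitz_on_balls_const)

lemma lipschitz_on_balls_mult:
  fixes f g :: "'a::real_normed_vector \<Rightarrow> real"
  assumes f: "lipschitz_on_balls f" and g: "lipschitz_on_balls g"
  shows "lipschitz_on_balls (\<lambda>x. f x * g x)"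
  unfolding lipschitz_on_balls_def
proof
  fix R :: real
  obtain L M where L: "L-lipschitz_on (cball 0 R) f" and M: "M-lipschitz_on (cball 0 R) g"
    using f g unfolding lipschitz_on_balls_def by blast
  \<comment> \<open>A Lipschitz function is bounded on the ball by comparison with its value at the
    centre. Writing \<open>\<bar>R\<bar>\<close> keeps the constants nonnegative when
    \<open>R < 0\<close> and the ball is empty.\<close>
  have bd: "\<bar>h x\<bar> \<le> \<bar>h 0\<bar> + K * \<bar>R\<bar>"
    if K: "K-lipschitz_on (cball 0 R) h" and x: "x \<in> cball 0 R" for h :: "'a \<Rightarrow> real" and K x
  proof -
    have "norm x \<le> R" using x by simp
    then have "0 \<le> R" using norm_ge_zero order_trans by blast
    have "\<bar>h x - h 0\<bar> \<le> K * norm x"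
      using lipschitz_onD[OF K x, of 0] \<open>0 \<le> R\<close> by (simp add: dist_norm)
    also have "\<dots> \<le> K * \<bar>R\<bar>"
      using lipschitz_on_nonneg[OF K] \<open>norm x \<le> R\<close> by (intro mult_left_mono) auto
    finally show ?thesis by linarith
  qed
  define A where "A = \<bar>f 0\<bar> + L * \<bar>R\<bar>"
  define B where "B = \<bar>g 0\<bar> + M * \<bar>R\<bar>"
  note nn = lipschitz_on_nonneg[OF L] lipschitz_on_nonneg[OF M]
  have "(A * M + B * L)-lipschitz_on (cball 0 R) (\<lambda>x. f x * g x)"
  proof (rule lipschitz_onI)
    show "0 \<le> A * M + B * L" using nn by (auto simp: A_def B_def)
    fix x y :: 'a assume x: "x \<in> cball 0 R" and y: "y \<in> cball 0 R"
    have "f x * g x - f y * g y = f x * (g x - g y) + g y * (f x - f y)"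
      by (simp add: algebra_simps)
    then have "\<bar>f x * g x - f y * g y\<bar> \<le> \<bar>f x\<bar> * \<bar>g x - g y\<bar> + \<bar>g y\<bar> * \<bar>f x - f y\<bar>"
      by (metis abs_mult abs_triangle_ineq)
    also have "\<dots> \<le> A * (M * dist x y) + B * (L * dist x y)"
      using lipschitz_onD[OF L x y] lipschitz_onD[OF M x y] bd[OF L x] bd[OF M y] nn
      by (intro add_mono mult_mono) (auto simp: dist_real_def A_def B_def)
    finally show "dist (f x * g x) (f y * g y) \<le> (A * M + B * L) * dist x y"
      by (simp add: dist_real_def algebra_simps)
  qed
  then show "\<exists>L. L-lipschitz_on (cball 0 R) (\<lambda>x. f x * g x)" by blast
qed

lemma lipschitz_on_balls_vec:
  fixes f :: "'a::real_normed_vector \<Rightarrow> real ^ 'n"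
  assumes "\<And>i. lipschitz_on_balls (\<lambda>x. f x $ i)"
  shows "lipschitz_on_balls f"
  unfolding lipschitz_on_balls_def
proof
  fix R :: real
  have "\<forall>i. \<exists>L. L-lipschitz_on (cball 0 R) (\<lambda>x. f x $ i)"
    using assms unfolding lipschitz_on_balls_def by blast
  then obtain L where L: "\<And>i. (L i)-lipschitz_on (cball 0 R) (\<lambda>x. f x $ i)"
    by metis
  have "(\<Sum>i\<in>UNIV. L i)-lipschitz_on (cball 0 R) f"
  proof (rule lipschitz_onI)
    fix x y :: 'a assume xy: "x \<in> cball 0 R" "y \<in> cball 0 R"
    have "dist (f x) (f y) \<le> (\<Sum>i\<in>UNIV. \<bar>(f x - f y) $ i\<bar>)"
      unfolding dist_norm by (rule norm_le_l1_cart)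
    also have "\<dots> \<le> (\<Sum>i\<in>UNIV. L i * dist x y)"
      using lipschitz_onD[OF L xy] by (intro sum_mono) (simp add: dist_real_def)
    finally show "dist (f x) (f y) \<le> (\<Sum>i\<in>UNIV. L i) * dist x y"
      by (simp add: sum_distrib_right)
  qed (intro sum_nonneg lipschitz_on_nonneg[OF L])
  then show "\<exists>L. L-lipschitz_on (cball 0 R) f" by blast
qed

text \<open>The condition does not depend on \<open>x\<close>: it is the case distinction on row and
  column in \<open>Lmat\<close>.\<close>

lemma lipschitz_on_balls_if:
  assumes "P \<Longrightarrow> lipschitz_on_balls f" "\<not> P \<Longrightarrow> lipschitz_on_balls g"
  shows "lipschitz_on_balls (\<lambda>x. if P then f x else g x)"
  using assms by (cases P) auto

lemmas lipschitz_on_balls_intros =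
  lipschitz_on_balls_if lipschitz_on_balls_const lipschitz_on_balls_component lipschitz_on_balls_add
  lipschitz_on_balls_mult lipschitz_on_balls_sum

subsection \<open>The vector field\<close>

definition vector_field ::
  "(real ^ 'n \<Rightarrow> real ^ 'n option ^ 'n option) \<Rightarrow> real ^ 'n \<Rightarrow> real ^ ('n::finite)" where
  "vector_field L z = (\<chi> i. (L z *v bar z) $ Some i)"

lemma vector_field_nth: "vector_field L z $ i = (\<Sum>q\<in>UNIV. L z $ Some i $ q * bar z $ q)"
  by (simp add: vector_field_def matrix_vector_mult_def)

lemma bar_nth [simp]: "bar z $ None = 1" "bar z $ Some i = z $ i"
  by (simp_all add: bar_def)

text \<open>As row 0 vanishes, component 0 of \<open>bar z\<close> has derivative 0, in keeping with
  its constant value 1. The map \<open>P\<close> forgets it, while \<open>bar\<close> is the linear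
  embedding \<open>Q\<close> shifted by \<open>bar 0\<close>, so derivatives transfer in both
  directions.\<close>

lemma solves_on_iff_vector_field:
  fixes L :: "real ^ 'n \<Rightarrow> real ^ 'n option ^ ('n::finite) option"
  assumes "\<And>z. (L z *v bar z) $ None = 0"
  shows "solves_on L J z \<longleftrightarrow>
    (\<forall>t\<in>J. (z has_vector_derivative vector_field L (z t)) (at t within J))"
proof -
  define P :: "real ^ 'n option \<Rightarrow> real ^ 'n" where "P x = (\<chi> i. x $ Some i)" for x
  define Q :: "real ^ 'n \<Rightarrow> real ^ 'n option" where
    "Q x = (\<chi> r. case r of None \<Rightarrow> 0 | Some i \<Rightarrow> x $ i)" for x
  have P: "bounded_linear P"
    unfolding P_def by (intro bounded_linearI'; simp add: vec_eq_iff)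
  have Q: "bounded_linear Q"
    unfolding Q_def by (intro bounded_linearI'; simp add: vec_eq_iff split: option.split)
  have Pbar: "P (bar x) = x" for x
    by (simp add: P_def vec_eq_iff)
  have Qbar: "bar x = Q x + bar 0" for x
    by (simp add: Q_def bar_def vec_eq_iff split: option.split)
  have PL: "P (L x *v bar x) = vector_field L x" for x
    by (simp add: P_def vector_field_def)
  have QL: "Q (vector_field L x) = L x *v bar x" for x
    using assms by (auto simp: Q_def vector_field_def vec_eq_iff split: option.split)
  have "((\<lambda>s. bar (z s)) has_vector_derivative L (z t) *v bar (z t)) (at t within J) \<longleftrightarrow>
      (z has_vector_derivative vector_field L (z t)) (at t within J)" for t
  proof
    assume "((\<lambda>s. bar (z s)) has_vector_derivative L (z t) *v bar (z t)) (at t within J)"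
    from bounded_linear.has_vector_derivative[OF P this]
    show "(z has_vector_derivative vector_field L (z t)) (at t within J)"
      by (simp add: Pbar PL)
  next
    assume "(z has_vector_derivative vector_field L (z t)) (at t within J)"
    from has_vector_derivative_add[OF bounded_linear.has_vector_derivative[OF Q this]
        has_vector_derivative_const[of "bar 0"]]
    show "((\<lambda>s. bar (z s)) has_vector_derivative L (z t) *v bar (z t)) (at t within J)"
      by (simp add: QL flip: Qbar)
  qed
  then show ?thesis
    by (simp add: solves_on_def)
qed

lemma Lmat_nth:
  "Lmat pos b \<beta> c \<gamma> \<Gamma> z $ r $ q =
    (if pos0 pos r = pos0 pos q \<and> pos0 pos r \<noteq> 0
     then real (pos0 pos r) * \<beta> z + real (pos0 pos r) * (real (pos0 pos r) - 1) / 2 * \<Gamma> z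
     else if pos0 pos r = pos0 pos q + 1
     then real (pos0 pos r) * b z + real (pos0 pos r) * (real (pos0 pos r) - 1) / 2 * \<gamma> z
     else if pos0 pos r = pos0 pos q + 2
     then real (pos0 pos r) * (real (pos0 pos r) - 1) / 2 * c z
     else 0)"
  by (simp add: Lmat_def Let_def)

lemma pos0_simps [simp]: "pos0 pos None = 0" "pos0 pos (Some i) = pos i"
  by (simp_all add: pos0_def)

lemma Lmat_row_None: "(Lmat pos b \<beta> c \<gamma> \<Gamma> z *v bar z) $ None = 0"
  by (simp add: matrix_vector_mult_def Lmat_nth)

lemma lipschitz_on_balls_Lmat:
  fixes b \<beta> c \<gamma> \<Gamma> :: "real ^ 'n::finite \<Rightarrow> real"
  assumes "lipschitz_on_balls b" "lipschitz_on_balls \<beta>" "lipschitz_on_balls c"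
    "lipschitz_on_balls \<gamma>" "lipschitz_on_balls \<Gamma>"
  shows "lipschitz_on_balls (\<lambda>z. Lmat pos b \<beta> c \<gamma> \<Gamma> z $ r $ q)"
  unfolding Lmat_nth
  by (intro lipschitz_on_balls_intros assms)

lemma lipschitz_on_balls_vector_field:
  assumes "\<And>r q. lipschitz_on_balls (\<lambda>z. L z $ r $ q)"
  shows "lipschitz_on_balls (vector_field L)"
proof (rule lipschitz_on_balls_vec)
  fix i
  have "lipschitz_on_balls (\<lambda>z::real ^ 'a. bar z $ q)" for q
    by (cases q) (auto intro: lipschitz_on_balls_intros)
  then show "lipschitz_on_balls (\<lambda>z. vector_field L z $ i)"
    unfolding vector_field_nth by (intro lipschitz_on_balls_intros assms)
qed

subsection \<open>The Lyapunov function\<close>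

text \<open>The \<open>i\<close>-th coordinate has weight \<open>i\<close>; the exponents \<open>2 * N! / i\<close> make every summand of the
  Lyapunov function an even power that is homogeneous of the same degree \<open>2 * N!\<close> in these weights.\<close>

definition lyapunov_exp :: "('n::finite \<Rightarrow> nat) \<Rightarrow> 'n \<Rightarrow> nat" where
  "lyapunov_exp pos i = 2 * (fact CARD('n) div pos i)"

definition lyapunov :: "('n::finite \<Rightarrow> nat) \<Rightarrow> real ^ 'n \<Rightarrow> real" where
  "lyapunov pos x = 1 + (\<Sum>i\<in>UNIV. (x $ i) ^ lyapunov_exp pos i)"

text \<open>Taking the root gives a quantity of weight 1. The summand 1 in \<open>lyapunov\<close>
  makes it at least 1, so that the constants in the growth conditions are absorbed by its
  powers.\<close>

definition weighted_radius :: "('n::finite \<Rightarrow> nat) \<Rightarrow> real ^ 'n \<Rightarrow> real" where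
  "weighted_radius pos x = root (2 * fact CARD('n)) (lyapunov pos x)"

section \<open>Coordinates and norms in terms of the Lyapunov function and the weighted
  radius\<close>

lemma numbering_range:
  fixes pos :: "'n::finite \<Rightarrow> nat"
  assumes "numbering pos"
  shows "1 \<le> pos i" "pos i \<le> CARD('n)"
  using assms unfolding numbering_def bij_betw_def by (metis atLeastAtMost_iff rangeI)+

lemma pos0_le:
  fixes pos :: "'n::finite \<Rightarrow> nat"
  assumes "numbering pos"
  shows "pos0 pos q \<le> CARD('n)"
  using numbering_range[OF assms] by (cases q) auto

lemma first_coord_eq:
  fixes pos :: "'n::finite \<Rightarrow> nat"
  assumes "numbering pos"
  obtains i where "pos i = 1" "\<And>x. first_coord pos x = x $ i"
proof -
  have "(1::nat) \<in> {1..CARD('n)}" by (simp add: Suc_leI)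
  then have "1 \<in> range pos" using assms unfolding numbering_def bij_betw_def by blast
  then obtain i where i: "pos i = 1" by auto
  have "inj pos" using assms unfolding numbering_def bij_betw_def by blast
  then have "(THE i. pos i = 1) = i"
    using i by (intro the_equality) (metis injD)+
  then show thesis using that i by (simp add: first_coord_def)
qed

lemma lyapunov_exp_mult_pos:
  fixes pos :: "'n::finite \<Rightarrow> nat"
  assumes "numbering pos"
  shows "pos i * lyapunov_exp pos i = 2 * fact CARD('n)"
proof -
  have "pos i dvd fact CARD('n)"
    using numbering_range[OF assms, of i] by (intro dvd_fact) auto
  then show ?thesis by (auto simp: lyapunov_exp_def)
qed

lemma lyapunov_exp_pos:
  fixes pos :: "'n::finite \<Rightarrow> nat"
  assumes "numbering pos"
  shows "0 < lyapunov_exp pos i"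
  using lyapunov_exp_mult_pos[OF assms, of i] by (metis fact_nonzero gr0I mult_0_right
      mult_eq_0_iff zero_neq_numeral)

lemma lyapunov_eq_abs: "lyapunov pos x = 1 + (\<Sum>i\<in>UNIV. \<bar>x $ i\<bar> ^ lyapunov_exp pos i)"
  by (simp add: lyapunov_def lyapunov_exp_def power_even_abs)

lemma abs_power_le_lyapunov: "1 + \<bar>x $ i\<bar> ^ lyapunov_exp pos i \<le> lyapunov pos x"
  unfolding lyapunov_eq_abs
  by (intro add_left_mono member_le_sum) auto

lemma lyapunov_ge_1: "1 \<le> lyapunov pos x"
  unfolding lyapunov_eq_abs by (simp add: sum_nonneg)

lemma abs_nth_le_lyapunov:
  assumes "numbering pos"
  shows "\<bar>x $ i\<bar> \<le> lyapunov pos x"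
proof (cases "\<bar>x $ i\<bar> \<le> 1")
  case True
  then show ?thesis using lyapunov_ge_1[of pos x] by linarith
next
  case False
  then have "\<bar>x $ i\<bar> ^ 1 \<le> \<bar>x $ i\<bar> ^ lyapunov_exp pos i"
    using lyapunov_exp_pos[OF assms, of i] by (intro power_increasing) auto
  then show ?thesis using abs_power_le_lyapunov[of x i pos] by simp
qed

lemma norm_le_lyapunov:
  fixes x :: "real ^ 'n::finite"
  assumes "numbering pos"
  shows "norm x \<le> CARD('n) * lyapunov pos x"
proof -
  have "norm x \<le> (\<Sum>i\<in>UNIV. \<bar>x $ i\<bar>)" by (rule norm_le_l1_cart)
  also have "\<dots> \<le> CARD('n) * lyapunov pos x"
    by (intro sum_bounded_above abs_nth_le_lyapunov assms)
  finally show ?thesis .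
qed

lemma weighted_radius_ge_1: "1 \<le> weighted_radius pos x"
  unfolding weighted_radius_def using lyapunov_ge_1[of pos x] by (intro real_root_ge_1_iff[THEN iffD2]) auto

lemma weighted_radius_power:
  fixes x :: "real ^ 'n::finite"
  shows "weighted_radius pos x ^ (2 * fact CARD('n)) = lyapunov pos x"
  unfolding weighted_radius_def using lyapunov_ge_1[of pos x] by (intro real_root_pow_pos2) auto

lemma abs_nth_le_weighted_radius:
  fixes x :: "real ^ 'n::finite"
  assumes "numbering pos"
  shows "\<bar>x $ i\<bar> \<le> weighted_radius pos x ^ pos i"
proof -
  have "\<bar>x $ i\<bar> ^ lyapunov_exp pos i \<le> (weighted_radius pos x ^ pos i) ^ lyapunov_exp pos i"
    using abs_power_le_lyapunov[of x i pos]
    by (simp add: lyapunov_exp_mult_pos[OF assms] weighted_radius_power flip: power_mult)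
  then show ?thesis
    using weighted_radius_ge_1[of pos x] lyapunov_exp_pos[OF assms]
    by (subst (asm) power_mono_iff) auto
qed

lemma abs_bar_le_weighted_radius:
  fixes x :: "real ^ 'n::finite"
  assumes "numbering pos"
  shows "\<bar>bar x $ q\<bar> \<le> weighted_radius pos x ^ pos0 pos q"
  using abs_nth_le_weighted_radius[OF assms] by (cases q) auto

text \<open>The exponent \<open>2 / i\<close> in \<open>normN\<close> matches the weight
  \<open>i\<close>: a coordinate of size at most \<open>\<rho>^i\<close> contributes at most
  \<open>\<rho>^2\<close>. The second bound uses \<open>N \<le> N^2\<close> to avoid a root of
  \<open>N\<close>.\<close>

lemma normN_le_weighted_radius:
  fixes x :: "real ^ 'n::finite"
  assumes "numbering pos"
  shows "(normN pos x)\<^sup>2 \<le> CARD('n) * (weighted_radius pos x)\<^sup>2"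
    and "normN pos x \<le> CARD('n) * weighted_radius pos x"
proof -
  let ?\<rho> = "weighted_radius pos x"
  note \<rho> = weighted_radius_ge_1[of pos x]
  have "\<bar>x $ i\<bar> powr (2 / real (pos i)) \<le> ?\<rho>\<^sup>2" for i
  proof -
    have "\<bar>x $ i\<bar> powr (2 / real (pos i)) \<le> (?\<rho> ^ pos i) powr (2 / real (pos i))"
      by (intro powr_mono2 abs_nth_le_weighted_radius assms) auto
    also have "\<dots> = (?\<rho> powr pos i) powr (2 / real (pos i))"
      using \<rho> by (simp add: powr_realpow)
    also have "\<dots> = ?\<rho> powr 2"
      using numbering_range(1)[OF assms, of i] by (simp add: powr_powr)
    also have "\<dots> = ?\<rho>\<^sup>2"
      using \<rho> by simp
    finally show ?thesis .
  qed
  then have "(\<Sum>i\<in>UNIV. \<bar>x $ i\<bar> powr (2 / real (pos i))) \<le> CARD('n) * ?\<rho>\<^sup>2"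
    by (intro sum_bounded_above) auto
  then show sq: "(normN pos x)\<^sup>2 \<le> CARD('n) * ?\<rho>\<^sup>2"
    by (simp add: normN_def sum_nonneg)
  have "real CARD('n) * ?\<rho>\<^sup>2 \<le> (real CARD('n))\<^sup>2 * ?\<rho>\<^sup>2"
    by (intro mult_right_mono self_le_power) (auto simp: Suc_leI)
  with sq have "(normN pos x)\<^sup>2 \<le> (CARD('n) * ?\<rho>)\<^sup>2"
    by (simp add: power_mult_distrib)
  then show "normN pos x \<le> CARD('n) * ?\<rho>"
    by (rule power2_le_imp_le) (use \<rho> in auto)
qed

text \<open>This is condition (B) at a single point with one common constant. The pointwise form
  serves condition (A), under which such a bound is available only where the first coordinate is
  controlled.\<close>

definition coeff_bound ::
  "('n::finite \<Rightarrow> nat) \<Rightarrow> (real ^ 'n \<Rightarrow> real) \<Rightarrow> (real ^ 'n \<Rightarrow> real) \<Rightarrow> (real ^ 'n \<Rightarrow> real)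
    \<Rightarrow> (real ^ 'n \<Rightarrow> real) \<Rightarrow> (real ^ 'n \<Rightarrow> real) \<Rightarrow> real \<Rightarrow> real ^ 'n \<Rightarrow> bool" where
  "coeff_bound pos b \<beta> c \<gamma> \<Gamma> K x \<longleftrightarrow> \<bar>\<beta> x\<bar> \<le> K \<and> \<bar>\<Gamma> x\<bar> \<le> K \<and>
    \<bar>b x\<bar> \<le> K * (1 + normN pos x) \<and> \<bar>\<gamma> x\<bar> \<le> K * (1 + normN pos x) \<and>
    \<bar>c x\<bar> \<le> K * (1 + (normN pos x)\<^sup>2)"

text \<open>A nonzero entry sits at offset \<open>m = 0, 1, 2\<close> below the diagonal. Its
  coefficient costs \<open>\<rho>^m\<close> and the coordinate it multiplies costs
  \<open>\<rho>^j\<close>, where \<open>j + m\<close> is the row number. The factor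
  \<open>N + N^2\<close> dominates the numerical factors \<open>k\<close> and
  \<open>k * (k - 1) / 2\<close>.\<close>

lemma abs_Lmat_mult_bar_le:
  fixes x :: "real ^ 'n::finite" and K :: real
  assumes num: "numbering pos" and K: "coeff_bound pos b \<beta> c \<gamma> \<Gamma> K x"
  shows "\<bar>Lmat pos b \<beta> c \<gamma> \<Gamma> x $ r $ q * bar x $ q\<bar> \<le>
    (real CARD('n) + (real CARD('n))\<^sup>2) * (K * (1 + real CARD('n))) * weighted_radius pos x ^ pos0 pos r"
proof -
  let ?\<rho> = "weighted_radius pos x" and ?N = "real CARD('n)" and ?k = "real (pos0 pos r)"
  let ?B = "Lmat pos b \<beta> c \<gamma> \<Gamma> x $ r $ q"
  \<comment> \<open>The factor \<open>1 + N\<close> comes from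
    \<open>1 + normN pos x \<le> (1 + N) * \<rho>\<close> and the analogous bound for
    squares.\<close>
  define D where "D = K * (1 + ?N)"
  have \<rho>: "1 \<le> ?\<rho>" by (rule weighted_radius_ge_1)
  then have \<rho>2: "1 \<le> ?\<rho>\<^sup>2" by (rule one_le_power)
  have K0: "0 \<le> K" using K unfolding coeff_bound_def by (meson abs_ge_zero order_trans)
  then have D0: "0 \<le> D" by (simp add: D_def)
  have "K \<le> D" using K0 by (simp add: D_def distrib_left)
  have "K * (1 + normN pos x) \<le> K * ((1 + ?N) * ?\<rho>)"
    using normN_le_weighted_radius(2)[OF num, of x] \<rho> K0
    by (intro mult_left_mono) (auto simp: algebra_simps)
  then have D1: "K * (1 + normN pos x) \<le> D * ?\<rho>" by (simp add: D_def)
  have "K * (1 + (normN pos x)\<^sup>2) \<le> K * ((1 + ?N) * ?\<rho>\<^sup>2)"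
    using normN_le_weighted_radius(1)[OF num, of x] \<rho>2 K0
    by (intro mult_left_mono) (auto simp: algebra_simps)
  then have D2: "K * (1 + (normN pos x)\<^sup>2) \<le> D * ?\<rho>\<^sup>2" by (simp add: D_def)
  have kN: "?k \<le> ?N" using pos0_le[OF num, of r] by simp
  have kk: "0 \<le> ?k * (?k - 1) / 2"
    by (cases "pos0 pos r") auto
  have "?k * (?k - 1) \<le> ?N * ?N"
    using kN by (cases "pos0 pos r") (auto intro!: mult_mono)
  then have kkN: "?k * (?k - 1) / 2 \<le> ?N\<^sup>2"
    using mult_nonneg_nonneg[of ?N ?N] unfolding power2_eq_square by linarith
  have comb: "\<bar>?k * u + ?k * (?k - 1) / 2 * v\<bar> \<le> (?N + ?N\<^sup>2) * w"
    if u: "\<bar>u\<bar> \<le> w" and v: "\<bar>v\<bar> \<le> w" for u v w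
  proof -
    have "\<bar>?k * u + ?k * (?k - 1) / 2 * v\<bar> \<le> ?k * \<bar>u\<bar> + ?k * (?k - 1) / 2 * \<bar>v\<bar>"
      using abs_triangle_ineq[of "?k * u" "?k * (?k - 1) / 2 * v"] kk
      by (simp only: abs_mult abs_of_nat abs_of_nonneg)
    also have "\<dots> \<le> ?N * w + ?N\<^sup>2 * w"
      by (intro add_mono mult_mono kN kkN u v) auto
    finally show ?thesis by (simp add: distrib_right)
  qed
  have fin: "\<bar>?B * bar x $ q\<bar> \<le> (?N + ?N\<^sup>2) * D * ?\<rho> ^ pos0 pos r"
    if "\<bar>?B\<bar> \<le> (?N + ?N\<^sup>2) * (D * ?\<rho> ^ m)" and "pos0 pos r = pos0 pos q + m" for m
  proof -
    have "\<bar>?B * bar x $ q\<bar> \<le> (?N + ?N\<^sup>2) * (D * ?\<rho> ^ m) * ?\<rho> ^ pos0 pos q"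
      unfolding abs_mult using that(1) abs_bar_le_weighted_radius[OF num, of x q] D0 \<rho>
      by (intro mult_mono) auto
    then show ?thesis by (simp add: that(2) power_add mult_ac)
  qed
  consider "pos0 pos r = pos0 pos q" "pos0 pos r \<noteq> 0" | "pos0 pos r = pos0 pos q + 1"
    | "pos0 pos r = pos0 pos q + 2" | "?B = 0"
    by (metis Lmat_nth)
  then have "\<bar>?B * bar x $ q\<bar> \<le> (?N + ?N\<^sup>2) * D * ?\<rho> ^ pos0 pos r"
  proof cases
    case 1
    then have "?B = ?k * \<beta> x + ?k * (?k - 1) / 2 * \<Gamma> x" by (simp add: Lmat_nth)
    moreover have "\<bar>\<beta> x\<bar> \<le> D" "\<bar>\<Gamma> x\<bar> \<le> D"
      using K \<open>K \<le> D\<close> unfolding coeff_bound_def by linarith+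
    ultimately show ?thesis using comb 1 by (intro fin[of 0]) auto
  next
    case 2
    then have "?B = ?k * b x + ?k * (?k - 1) / 2 * \<gamma> x" by (simp add: Lmat_nth)
    moreover have "\<bar>b x\<bar> \<le> D * ?\<rho>" "\<bar>\<gamma> x\<bar> \<le> D * ?\<rho>"
      using K D1 unfolding coeff_bound_def by linarith+
    ultimately show ?thesis using comb 2 by (intro fin[of 1]) auto
  next
    case 3
    \<comment> \<open>The zero summand brings this entry into the shape treated by
      \<open>comb\<close>.\<close>
    then have "?B = ?k * 0 + ?k * (?k - 1) / 2 * c x" by (simp add: Lmat_nth)
    moreover have "\<bar>c x\<bar> \<le> D * ?\<rho>\<^sup>2"
      using K D2 unfolding coeff_bound_def by linarith
    ultimately show ?thesis using comb[of 0 "D * ?\<rho>\<^sup>2" "c x"] D0 3 by (intro fin[of 2]) auto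
  next
    case 4
    then show ?thesis using D0 \<rho> by (simp)
  qed
  then show ?thesis by (simp add: D_def)
qed

lemma abs_vector_field_le:
  fixes x :: "real ^ 'n::finite"
  assumes "numbering pos" "coeff_bound pos b \<beta> c \<gamma> \<Gamma> K x"
  shows "\<bar>vector_field (Lmat pos b \<beta> c \<gamma> \<Gamma>) x $ i\<bar> \<le>
    real CARD('n option) * ((real CARD('n) + (real CARD('n))\<^sup>2) * (K * (1 + real CARD('n)))) * weighted_radius pos x ^ pos i"
proof -
  have "\<bar>vector_field (Lmat pos b \<beta> c \<gamma> \<Gamma>) x $ i\<bar> \<le>
      (\<Sum>q\<in>UNIV. \<bar>Lmat pos b \<beta> c \<gamma> \<Gamma> x $ Some i $ q * bar x $ q\<bar>)"
    unfolding vector_field_nth by (rule sum_abs)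
  also have "\<dots> \<le> real CARD('n option) * ((real CARD('n) + (real CARD('n))\<^sup>2) * (K * (1 + real CARD('n)))
      * weighted_radius pos x ^ pos i)"
    using abs_Lmat_mult_bar_le[OF assms, of "Some i"] by (intro sum_bounded_above) simp
  finally show ?thesis by (simp only: mult.assoc)
qed

text \<open>Differentiating a summand lowers its degree by the weight of the coordinate, and the
  vector field component restores exactly that weight, so each term is at most a multiple of
  \<open>lyapunov\<close>. The constant \<open>C\<close> is fixed before \<open>z\<close> and
  \<open>t\<close>, which gives a bound uniform over solutions.\<close>

lemma lyapunov_growth:
  fixes pos :: "'n::finite \<Rightarrow> nat"
  assumes num: "numbering pos"
  obtains C where "\<And>z t. \<lbrakk>0 \<le> t;
      \<And>s. s \<in> {0..t} \<Longrightarrow>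
        (z has_vector_derivative vector_field (Lmat pos b \<beta> c \<gamma> \<Gamma>) (z s)) (at s within {0..t});
      \<And>s. s \<in> {0..t} \<Longrightarrow> coeff_bound pos b \<beta> c \<gamma> \<Gamma> K (z s)\<rbrakk>
    \<Longrightarrow> lyapunov pos (z t) \<le> lyapunov pos (z 0) * exp (C * t)"
proof -
  define E where "E = real CARD('n option) * ((real CARD('n) + (real CARD('n))\<^sup>2) * (K * (1 + real CARD('n))))"
  let ?F = "vector_field (Lmat pos b \<beta> c \<gamma> \<Gamma>)" and ?e = "lyapunov_exp pos"
  define C where "C = (\<Sum>i\<in>UNIV. real (?e i) * E)"
  show thesis
  proof
    fix z :: "real \<Rightarrow> real ^ 'n" and t :: real
    assume t: "0 \<le> t"
      and dz: "\<And>s. s \<in> {0..t} \<Longrightarrow> (z has_vector_derivative ?F (z s)) (at s within {0..t})"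
      and K: "\<And>s. s \<in> {0..t} \<Longrightarrow> coeff_bound pos b \<beta> c \<gamma> \<Gamma> K (z s)"
    show "lyapunov pos (z t) \<le> lyapunov pos (z 0) * exp (C * t)"
    proof (rule differential_gronwall[OF t])
      fix s assume s: "s \<in> {0..t}"
      have "((\<lambda>s. z s $ i) has_real_derivative ?F (z s) $ i) (at s within {0..t})" for i
        unfolding has_real_derivative_iff_has_vector_derivative
        by (rule bounded_linear.has_vector_derivative[OF bounded_linear_vec_nth dz[OF s]])
      then have "((\<lambda>s. lyapunov pos (z s)) has_real_derivative
          (\<Sum>i\<in>UNIV. ?e i * (z s $ i) ^ (?e i - 1) * ?F (z s) $ i)) (at s within {0..t})"
        unfolding lyapunov_def
        by (auto intro!: derivative_eq_intros sum.cong)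
      then show "((\<lambda>s. lyapunov pos (z s)) has_vector_derivative
          (\<Sum>i\<in>UNIV. ?e i * (z s $ i) ^ (?e i - 1) * ?F (z s) $ i)) (at s within {0..t})"
        by (simp add: has_real_derivative_iff_has_vector_derivative)
      let ?\<rho> = "weighted_radius pos (z s)"
      have \<rho>: "1 \<le> ?\<rho>" by (rule weighted_radius_ge_1)
      have "?e i * (z s $ i) ^ (?e i - 1) * ?F (z s) $ i \<le> real (?e i) * E * lyapunov pos (z s)" for i
      proof -
        have "(z s $ i) ^ (?e i - 1) * ?F (z s) $ i \<le> \<bar>z s $ i\<bar> ^ (?e i - 1) * \<bar>?F (z s) $ i\<bar>"
          by (metis abs_ge_self abs_mult power_abs)
        also have "\<dots> \<le> (?\<rho> ^ pos i) ^ (?e i - 1) * (E * ?\<rho> ^ pos i)"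
          using abs_nth_le_weighted_radius[OF num, of "z s" i] abs_vector_field_le[OF num K[OF s], of i] \<rho>
          by (intro mult_mono power_mono) (auto simp: E_def)
        also have "\<dots> = E * (?\<rho> ^ pos i) ^ (?e i)"
          using lyapunov_exp_pos[OF num, of i] by (simp add: power_eq_if)
        also have "\<dots> = E * lyapunov pos (z s)"
          by (simp add: lyapunov_exp_mult_pos[OF num] weighted_radius_power flip: power_mult)
        finally show ?thesis
          by (simp add: mult.assoc mult_left_mono)
      qed
      then show "(\<Sum>i\<in>UNIV. ?e i * (z s $ i) ^ (?e i - 1) * ?F (z s) $ i) \<le> C * lyapunov pos (z s)"
        unfolding C_def sum_distrib_right by (rule sum_mono)
    qed
  qed
qed

subsection \<open>A priori bounds\<close>

lemma normN_nonneg: "0 \<le> normN pos x"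
  by (simp add: normN_def sum_nonneg)

lemma growth_B_imp_coeff_bound:
  assumes "growth_B pos b \<beta> c \<gamma> \<Gamma>"
  shows "\<exists>K. \<forall>x. coeff_bound pos b \<beta> c \<gamma> \<Gamma> K x"
proof -
  obtain \<beta>0 \<Gamma>0 c0 b0 \<gamma>0 where
    bd: "0 \<le> \<beta>0" "0 \<le> \<Gamma>0" "\<And>x. \<bar>\<beta> x\<bar> \<le> \<beta>0" "\<And>x. \<bar>\<Gamma> x\<bar> \<le> \<Gamma>0"
      "\<And>x. \<bar>c x\<bar> \<le> c0 * (1 + (normN pos x)\<^sup>2)"
      "\<And>x. \<bar>\<gamma> x\<bar> \<le> \<gamma>0 * (1 + normN pos x)" "\<And>x. \<bar>b x\<bar> \<le> b0 * (1 + normN pos x)"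
    using assms unfolding growth_B_def by metis
  \<comment> \<open>The sum dominates every single constant; absolute values are taken where the
    sign is not prescribed.\<close>
  define K where "K = \<beta>0 + \<Gamma>0 + \<bar>c0\<bar> + \<bar>b0\<bar> + \<bar>\<gamma>0\<bar>"
  have K: "\<beta>0 \<le> K" "\<Gamma>0 \<le> K" "c0 \<le> K" "b0 \<le> K" "\<gamma>0 \<le> K"
    using bd(1,2) unfolding K_def by linarith+
  have "coeff_bound pos b \<beta> c \<gamma> \<Gamma> K x" for x
    unfolding coeff_bound_def using normN_nonneg[of pos x]
    by (intro conjI order_trans[OF bd(3)] order_trans[OF bd(4)] order_trans[OF bd(5)]
        order_trans[OF bd(6)] order_trans[OF bd(7)] mult_right_mono K) auto
  then show ?thesis by blast
qed

text \<open>For a bounded first coordinate the monotone functions are bounded by their values at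
  \<open>M\<close>, and what remains of (A) has the form of (B).\<close>

lemma growth_A_imp_coeff_bound:
  assumes "growth_A pos b \<beta> c \<gamma> \<Gamma>" and "0 \<le> M"
  shows "\<exists>K. \<forall>x. \<bar>first_coord pos x\<bar> \<le> M \<longrightarrow> coeff_bound pos b \<beta> c \<gamma> \<Gamma> K x"
proof -
  obtain \<beta>0 \<Gamma>0 c0 f b0 \<gamma>0 g where
    bd: "0 \<le> \<beta>0" "0 \<le> \<Gamma>0" "\<And>x. \<bar>\<beta> x\<bar> \<le> \<beta>0" "\<And>x. \<bar>\<Gamma> x\<bar> \<le> \<Gamma>0"
      "\<And>x. \<bar>c x\<bar> \<le> c0 * (1 + f \<bar>first_coord pos x\<bar> + (normN pos x)\<^sup>2)"
      "\<And>x. \<bar>\<gamma> x\<bar> \<le> \<gamma>0 * (1 + g \<bar>first_coord pos x\<bar> + normN pos x)"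
      "\<And>x. \<bar>b x\<bar> \<le> b0 * (1 + \<bar>first_coord pos x\<bar>)"
    and fg: "growth_function f" "growth_function g"
    using assms(1) unfolding growth_A_def by metis
  have mono: "0 \<le> h u" "h u \<le> h M" if "growth_function h" "0 \<le> u" "u \<le> M" for h u
    using that mono_onD[of "{0..}" h u M] unfolding growth_function_def by auto
  have bound: "a * (1 + u + n) \<le> \<bar>a\<bar> * (1 + v) * (1 + n)" if "0 \<le> u" "u \<le> v" "0 \<le> n" for a u v n :: real
  proof -
    have "a * (1 + u + n) \<le> \<bar>a\<bar> * (1 + u + n)"
      using that by (intro mult_right_mono) auto
    also have "\<dots> \<le> \<bar>a\<bar> * ((1 + v) * (1 + n))"
      using that mult_nonneg_nonneg[of v n] by (intro mult_left_mono) (simp_all add: algebra_simps add_increasing2)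
    finally show ?thesis by (simp add: mult.assoc)
  qed
  define K where "K = \<beta>0 + \<Gamma>0 + \<bar>c0\<bar> * (1 + f M) + \<bar>b0\<bar> * (1 + M) + \<bar>\<gamma>0\<bar> * (1 + g M)"
  have "0 \<le> \<bar>c0\<bar> * (1 + f M)" "0 \<le> \<bar>b0\<bar> * (1 + M)" "0 \<le> \<bar>\<gamma>0\<bar> * (1 + g M)"
    using mono(1)[OF fg(1), of M] mono(1)[OF fg(2), of M] \<open>0 \<le> M\<close> by auto
  then have K: "\<beta>0 \<le> K" "\<Gamma>0 \<le> K" "\<bar>c0\<bar> * (1 + f M) \<le> K" "\<bar>b0\<bar> * (1 + M) \<le> K"
      "\<bar>\<gamma>0\<bar> * (1 + g M) \<le> K"
    using bd(1,2) unfolding K_def by linarith+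
  have "coeff_bound pos b \<beta> c \<gamma> \<Gamma> K x" if x: "\<bar>first_coord pos x\<bar> \<le> M" for x
  proof -
    note n = normN_nonneg[of pos x]
    have "\<bar>c x\<bar> \<le> \<bar>c0\<bar> * (1 + f M) * (1 + (normN pos x)\<^sup>2)"
      using bd(5)[of x] bound[OF mono[OF fg(1) _ x], of "(normN pos x)\<^sup>2" c0] by simp
    also have "\<dots> \<le> K * (1 + (normN pos x)\<^sup>2)"
      by (intro mult_right_mono K) auto
    finally have c: "\<bar>c x\<bar> \<le> K * (1 + (normN pos x)\<^sup>2)" .
    have "\<bar>\<gamma> x\<bar> \<le> \<bar>\<gamma>0\<bar> * (1 + g M) * (1 + normN pos x)"
      using bd(6)[of x] bound[OF mono[OF fg(2) _ x] n, of \<gamma>0] by simp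
    also have "\<dots> \<le> K * (1 + normN pos x)"
      using n by (intro mult_right_mono K) auto
    finally have \<gamma>: "\<bar>\<gamma> x\<bar> \<le> K * (1 + normN pos x)" .
    have "\<bar>b x\<bar> \<le> b0 * (1 + \<bar>first_coord pos x\<bar>)"
      by (rule bd)
    also have "\<dots> \<le> \<bar>b0\<bar> * (1 + M)"
      using x by (intro mult_mono) auto
    also have "\<dots> \<le> K"
      by (rule K)
    also have "\<dots> \<le> K * (1 + normN pos x)"
      using n bd(1) K(1) by (simp add: distrib_left)
    finally have b: "\<bar>b x\<bar> \<le> K * (1 + normN pos x)" .
    show ?thesis
      unfolding coeff_bound_def
      using order_trans[OF bd(3) K(1)] order_trans[OF bd(4) K(2)] b c \<gamma> by blast
  qed
  then show ?thesis by blast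
qed

text \<open>In row 1 the factor \<open>k * (k - 1) / 2\<close> vanishes, so only
  \<open>\<beta>\<close> and \<open>b\<close> enter. Under (A) both are controlled by the first
  coordinate alone, which yields a closed linear differential inequality for
  \<open>1 + z\<^sub>1\<^sup>2\<close>.\<close>

lemma growth_A_first_coord:
  fixes pos :: "'n::finite \<Rightarrow> nat"
  assumes num: "numbering pos" and A: "growth_A pos b \<beta> c \<gamma> \<Gamma>"
  obtains C where "0 \<le> C" "\<And>z t. \<lbrakk>0 \<le> t;
      \<And>s. s \<in> {0..t} \<Longrightarrow>
        (z has_vector_derivative vector_field (Lmat pos b \<beta> c \<gamma> \<Gamma>) (z s)) (at s within {0..t})\<rbrakk>
    \<Longrightarrow> 1 + (first_coord pos (z t))\<^sup>2 \<le> (1 + (first_coord pos (z 0))\<^sup>2) * exp (C * t)"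
proof -
  let ?L = "Lmat pos b \<beta> c \<gamma> \<Gamma>"
  let ?F = "vector_field ?L"
  obtain i where i: "pos i = 1" and fc: "\<And>x. first_coord pos x = x $ i"
    using first_coord_eq[OF num] by metis
  have "inj pos" using num unfolding numbering_def bij_betw_def by blast
  obtain \<beta>0 b0 where \<beta>0: "0 \<le> \<beta>0" "\<And>x. \<bar>\<beta> x\<bar> \<le> \<beta>0"
    and b0: "\<And>x. \<bar>b x\<bar> \<le> b0 * (1 + \<bar>x $ i\<bar>)"
    using A unfolding growth_A_def fc by metis
  define D where "D = \<beta>0 + \<bar>b0\<bar>"
  have D: "0 \<le> D" "\<beta>0 \<le> D" "b0 \<le> D" using \<beta>0 by (auto simp: D_def)
  have F: "\<bar>?F x $ i\<bar> \<le> real CARD('n option) * (D * (1 + \<bar>x $ i\<bar>))" for x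
  proof -
    have term_le: "\<bar>?L x $ Some i $ q * bar x $ q\<bar> \<le> D * (1 + \<bar>x $ i\<bar>)" for q
    proof (cases q)
      case None
      have "\<bar>b x\<bar> \<le> D * (1 + \<bar>x $ i\<bar>)"
        using b0[of x] mult_right_mono[OF D(3), of "1 + \<bar>x $ i\<bar>"] by simp
      then show ?thesis using None i by (simp add: Lmat_nth)
    next
      case (Some j)
      have "\<bar>\<beta> x\<bar> * \<bar>x $ i\<bar> \<le> D * (1 + \<bar>x $ i\<bar>)"
        using \<beta>0(2)[of x] D by (intro mult_mono) auto
      moreover have "?L x $ Some i $ q = (if j = i then \<beta> x else 0)"
      proof (cases "j = i")
        case True
        then show ?thesis using Some i by (simp add: Lmat_nth)
      next
        case False
        then have "pos j \<noteq> 1" "1 \<le> pos j"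
          using injD[OF \<open>inj pos\<close>, of j i] i numbering_range(1)[OF num, of j] by auto
        then show ?thesis using Some i False by (simp add: Lmat_nth)
      qed
      ultimately show ?thesis
        using Some D(1) by (simp add: abs_mult)
    qed
    have "\<bar>?F x $ i\<bar> \<le> (\<Sum>q\<in>UNIV. \<bar>?L x $ Some i $ q * bar x $ q\<bar>)"
      unfolding vector_field_nth by (rule sum_abs)
    also have "\<dots> \<le> real CARD('n option) * (D * (1 + \<bar>x $ i\<bar>))"
      by (intro sum_bounded_above term_le)
    finally show ?thesis .
  qed
  define E where "E = real CARD('n option) * D"
  have E: "0 \<le> E" using D by (simp add: E_def)
  show thesis
  proof
    show "0 \<le> 4 * E" using E by simp
    fix z :: "real \<Rightarrow> real ^ 'n" and t :: real
    assume t: "0 \<le> t"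
      and dz: "\<And>s. s \<in> {0..t} \<Longrightarrow> (z has_vector_derivative ?F (z s)) (at s within {0..t})"
    show "1 + (first_coord pos (z t))\<^sup>2 \<le> (1 + (first_coord pos (z 0))\<^sup>2) * exp (4 * E * t)"
      unfolding fc
    proof (rule differential_gronwall[OF t])
      fix s assume s: "s \<in> {0..t}"
      have "((\<lambda>s. z s $ i) has_real_derivative ?F (z s) $ i) (at s within {0..t})"
        unfolding has_real_derivative_iff_has_vector_derivative
        by (rule bounded_linear.has_vector_derivative[OF bounded_linear_vec_nth dz[OF s]])
      then show "((\<lambda>s. 1 + (z s $ i)\<^sup>2) has_vector_derivative 2 * (z s $ i) * ?F (z s) $ i)
          (at s within {0..t})"
        unfolding has_real_derivative_iff_has_vector_derivative[symmetric]
        by (auto intro!: derivative_eq_intros)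
      let ?a = "\<bar>z s $ i\<bar>"
      have "(z s $ i) * ?F (z s) $ i \<le> ?a * \<bar>?F (z s) $ i\<bar>"
        by (metis abs_ge_self abs_mult)
      also have "\<dots> \<le> ?a * (E * (1 + ?a))"
        using F[of "z s"] by (intro mult_left_mono) (auto simp: E_def mult.assoc)
      also have "\<dots> = E * (?a * (1 + ?a))"
        by (simp only: mult.left_commute)
      \<comment> \<open>For \<open>a \<ge> 0\<close> the difference
        \<open>2 + 2 * a^2 - a * (1 + a)\<close> equals \<open>(a - 1)^2 + a + 1\<close>. Together
        with the 2 from differentiating the square this gives \<open>4 * E\<close>.\<close>
      also have "\<dots> \<le> E * (2 * (1 + ?a\<^sup>2))"
        using E zero_le_power2[of "?a - 1"]
        by (intro mult_left_mono) (auto simp: power2_eq_square algebra_simps)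
      finally show "2 * (z s $ i) * ?F (z s) $ i \<le> 4 * E * (1 + (z s $ i)\<^sup>2)"
        by (simp add: algebra_simps)
    qed
  qed
qed

lemma vector_field_a_priori_bound:
  fixes pos :: "'n::finite \<Rightarrow> nat"
  assumes num: "numbering pos"
    and growth: "growth_A pos b \<beta> c \<gamma> \<Gamma> \<or> growth_B pos b \<beta> c \<gamma> \<Gamma>"
    and "0 \<le> T"
  shows "\<exists>R. \<forall>z. \<forall>t\<in>{0..T}. z 0 = z0 \<and>
    (\<forall>s\<in>{0..t}. (z has_vector_derivative vector_field (Lmat pos b \<beta> c \<gamma> \<Gamma>) (z s)) (at s within {0..t})) \<longrightarrow>
    norm (z t) \<le> R"
proof -
  let ?F = "vector_field (Lmat pos b \<beta> c \<gamma> \<Gamma>)"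
  \<comment> \<open>First a coefficient bound along all solutions up to time \<open>T\<close>,
    uniform in the solution; only then can the Lyapunov function be used.\<close>
  have "\<exists>K. \<forall>z t. 0 \<le> t \<and> t \<le> T \<and> z 0 = z0 \<and>
      (\<forall>s\<in>{0..t}. (z has_vector_derivative ?F (z s)) (at s within {0..t})) \<longrightarrow>
      coeff_bound pos b \<beta> c \<gamma> \<Gamma> K (z t)"
    using growth
  proof
    assume A: "growth_A pos b \<beta> c \<gamma> \<Gamma>"
    obtain C where "0 \<le> C" and C: "\<And>z t. \<lbrakk>0 \<le> t;
        \<And>s. s \<in> {0..t} \<Longrightarrow> (z has_vector_derivative ?F (z s)) (at s within {0..t})\<rbrakk>
      \<Longrightarrow> 1 + (first_coord pos (z t))\<^sup>2 \<le> (1 + (first_coord pos (z 0))\<^sup>2) * exp (C * t)"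
      using growth_A_first_coord[OF num A] by blast
    define M where "M = (1 + (first_coord pos z0)\<^sup>2) * exp (C * T)"
    have "0 \<le> M" by (simp add: M_def)
    obtain K where K: "\<And>x. \<bar>first_coord pos x\<bar> \<le> M \<Longrightarrow> coeff_bound pos b \<beta> c \<gamma> \<Gamma> K x"
      using growth_A_imp_coeff_bound[OF A \<open>0 \<le> M\<close>] by blast
    have "\<bar>first_coord pos (z t)\<bar> \<le> M"
      if "0 \<le> t" "t \<le> T" "z 0 = z0"
        and "\<And>s. s \<in> {0..t} \<Longrightarrow> (z has_vector_derivative ?F (z s)) (at s within {0..t})" for z t
    proof -
      have "\<bar>u\<bar> \<le> 1 + u\<^sup>2" for u :: real
        using zero_le_power2[of "\<bar>u\<bar> - 1"] by (simp add: power2_diff)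
      then have "\<bar>first_coord pos (z t)\<bar> \<le> 1 + (first_coord pos (z t))\<^sup>2" .
      also have "\<dots> \<le> (1 + (first_coord pos z0)\<^sup>2) * exp (C * t)"
        using C[OF that(1,4)] that(3) by simp
      also have "\<dots> \<le> M"
        unfolding M_def using \<open>t \<le> T\<close> \<open>0 \<le> C\<close> by (intro mult_left_mono) (auto intro: mult_left_mono)
      finally show ?thesis .
    qed
    then show ?thesis using K by blast
  next
    assume "growth_B pos b \<beta> c \<gamma> \<Gamma>"
    then obtain K where "\<forall>x. coeff_bound pos b \<beta> c \<gamma> \<Gamma> K x"
      using growth_B_imp_coeff_bound by blast
    then show ?thesis by (intro exI[of _ K]) simp
  qed
  then obtain K where K: "\<And>z t. \<lbrakk>0 \<le> t; t \<le> T; z 0 = z0;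
      \<And>s. s \<in> {0..t} \<Longrightarrow> (z has_vector_derivative ?F (z s)) (at s within {0..t})\<rbrakk>
    \<Longrightarrow> coeff_bound pos b \<beta> c \<gamma> \<Gamma> K (z t)"
    by blast
  obtain C where C: "\<And>z t. \<lbrakk>0 \<le> t;
      \<And>s. s \<in> {0..t} \<Longrightarrow> (z has_vector_derivative ?F (z s)) (at s within {0..t});
      \<And>s. s \<in> {0..t} \<Longrightarrow> coeff_bound pos b \<beta> c \<gamma> \<Gamma> K (z s)\<rbrakk>
    \<Longrightarrow> lyapunov pos (z t) \<le> lyapunov pos (z 0) * exp (C * t)"
    using lyapunov_growth[OF num] by blast
  show ?thesis
  proof (intro exI allI ballI impI, elim conjE)
    fix z t
    assume "t \<in> {0..T}" and z0: "z 0 = z0"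
      and "\<forall>s\<in>{0..t}. (z has_vector_derivative ?F (z s)) (at s within {0..t})"
    then have t: "0 \<le> t" "t \<le> T"
      and dz: "\<And>s. s \<in> {0..t} \<Longrightarrow> (z has_vector_derivative ?F (z s)) (at s within {0..t})"
      by auto
    \<comment> \<open>The choice of \<open>K\<close> controls the end point of a solution, so each
      intermediate time \<open>s\<close> is reached by restricting to \<open>[0, s]\<close>.\<close>
    have "coeff_bound pos b \<beta> c \<gamma> \<Gamma> K (z s)" if s: "s \<in> {0..t}" for s
    proof (rule K)
      show "(z has_vector_derivative ?F (z r)) (at r within {0..s})" if "r \<in> {0..s}" for r
        by (rule has_vector_derivative_within_subset[OF dz]) (use s that in auto)
    qed (use s t z0 in auto)
    then have "lyapunov pos (z t) \<le> lyapunov pos z0 * exp (C * t)"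
      using C[OF t(1) dz] z0 by simp
    \<comment> \<open>The sign of \<open>C\<close> is unknown; \<open>\<bar>C\<bar> * T\<close>
      removes the dependence on \<open>t\<close>.\<close>
    also have "\<dots> \<le> lyapunov pos z0 * exp (\<bar>C\<bar> * T)"
      using t lyapunov_ge_1[of pos z0] by (intro mult_left_mono) (auto intro: mult_mono)
    finally have "CARD('n) * lyapunov pos (z t) \<le> CARD('n) * (lyapunov pos z0 * exp (\<bar>C\<bar> * T))"
      by (intro mult_left_mono) auto
    then show "norm (z t) \<le> CARD('n) * (lyapunov pos z0 * exp (\<bar>C\<bar> * T))"
      using norm_le_lyapunov[OF num, of "z t"] by linarith
  qed
qed

text \<open>The second conjunct expresses that \<open>z\<close> is the solution: any solution on an
  interval of nonnegative times containing 0, half-open or closed, is a restriction of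
  \<open>z\<close>.\<close>

theorem proposition3p6:
  fixes pos :: "'n::finite \<Rightarrow> nat"
    and b \<beta> c \<gamma> \<Gamma> :: "real ^ 'n \<Rightarrow> real"
    and z0 :: "real ^ 'n"
  assumes "numbering pos"
    and "locally_lipschitz b" "locally_lipschitz \<beta>" "locally_lipschitz c"
      "locally_lipschitz \<gamma>" "locally_lipschitz \<Gamma>"
    and "growth_A pos b \<beta> c \<gamma> \<Gamma> \<or> growth_B pos b \<beta> c \<gamma> \<Gamma>"
  shows "\<exists>z. z 0 = z0 \<and> solves_on (Lmat pos b \<beta> c \<gamma> \<Gamma>) {0..} z \<and>
    (\<forall>J y. is_interval J \<and> 0 \<in> J \<and> J \<subseteq> {0..} \<and> y 0 = z0 \<and>
        solves_on (Lmat pos b \<beta> c \<gamma> \<Gamma>) J y \<longrightarrow> (\<forall>t\<in>J. y t = z t))"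
proof -
  let ?L = "Lmat pos b \<beta> c \<gamma> \<Gamma>"
  have "lipschitz_on_balls (vector_field ?L)"
    by (intro lipschitz_on_balls_vector_field lipschitz_on_balls_Lmat
        locally_lipschitz_imp_lipschitz_on_balls assms)
  then have lip: "\<exists>L. L-lipschitz_on (cball 0 R) (vector_field ?L)" for R
    by (simp add: lipschitz_on_balls_def)
  note iff = solves_on_iff_vector_field[of ?L, OF Lmat_row_None]
  have "\<exists>z. z 0 = z0 \<and> (\<forall>t\<ge>0. (z has_vector_derivative vector_field ?L (z t)) (at t within {0..}))"
    by (rule ode_global_existence[OF lip vector_field_a_priori_bound[OF assms(1,7)]])
  then obtain z where z0: "z 0 = z0"
    and dz: "\<And>t. 0 \<le> t \<Longrightarrow> (z has_vector_derivative vector_field ?L (z t)) (at t within {0..})"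
    by blast
  have "y t = z t"
    if J: "is_interval J" "0 \<in> J" "J \<subseteq> {0..}" and y0: "y 0 = z0" and y: "solves_on ?L J y" and t: "t \<in> J"
    for J y t
  proof (rule ode_unique[OF lip, of t y z])
    have sub: "{0..t} \<subseteq> J"
      using J(1,2) t unfolding is_interval_1 by (meson atLeastAtMost_iff subsetI)
    show "0 \<le> t" using J(3) t by auto
    show "y 0 = z 0" using y0 z0 by simp
    fix s assume s: "s \<in> {0..t}"
    have "(y has_vector_derivative vector_field ?L (y s)) (at s within J)"
      using y s sub by (auto simp: iff)
    then show "(y has_vector_derivative vector_field ?L (y s)) (at s within {0..t})"
      by (rule has_vector_derivative_within_subset) (rule sub)
    show "(z has_vector_derivative vector_field ?L (z s)) (at s within {0..t})"
      using s by (intro has_vector_derivative_within_subset[OF dz]) auto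
  qed
  moreover have "solves_on ?L {0..} z"
    using dz by (simp add: iff)
  ultimately show ?thesis using z0 by blast
qed

end
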